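(* Let $X$ be an ordered Banach space. The following assertions are equivalent: (i) Every increasing sequence in $X$ that is order bounded from above is norm convergent (i.e. $X$ has the Levi property). (ii) Every increasing net in $X$ that is order bounded from above is norm convergent. (iii) Every increasing net in $X$ that has a minimal upper bound is norm convergent. If the equivalent conditions (i)--(iii) are satisfied, then the cone $X_+$ is normal.
   Context: An ordered Banach space is a real Banach space $X$ together with a norm closed cone $X_+$, i.e. a norm closed non-empty subset $X_+ \subseteq X$ with $\alpha X_+ + \beta X_+ \subseteq X_+$ for all scalars $\alpha,\beta \in [0,\infty)$ and $X_+ \cap (-X_+) = \{0\}$. The partial order is given by $x \le y$ iff $y - x \in X_+$. A net $(x_j)_{j\in J}$ (with $J$ a directed set) is increasing if $x_j \le x_k$ whenever $j \le k$. An upper bound of a set (or net) $S \subseteq X$ is a vector $z \in X$ with $y \le z$ for all $y \in S$; $S$ is order bounded from above if it has an upper bound. An upper bound $z$ of $S$ is a minimal upper bound if for every upper bound $\tilde z$ of $S$ the inequality $\tilde z \le z$ implies $\tilde z = z$. The cone $X_+$ is normal if there is a constant $C \ge 0$ such that $\|x\| \le C\|y\|$ for all $x,y \in X$ with $0 \le x \le y$. *)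

theory Defs
  imports "HOL-Analysis.Analysis"
begin

(* The cone is {0..}. The class ordered_real_vector makes it a pointed convex cone that induces
   the order: x <= y iff y - x lies in {0..}. Closedness is the only further requirement. *)
class ordered_banach = banach + ordered_real_vector +
  assumes closed_cone: "closed {0..}"

definition upper_bound :: "'a::order set \<Rightarrow> 'a \<Rightarrow> bool" where
  "upper_bound S z \<longleftrightarrow> (\<forall>y\<in>S. y \<le> z)"

definition minimal_upper_bound :: "'a::order set \<Rightarrow> 'a \<Rightarrow> bool" where
  "minimal_upper_bound S z \<longleftrightarrow>
     upper_bound S z \<and> (\<forall>z'. upper_bound S z' \<longrightarrow> z' \<le> z \<longrightarrow> z' = z)"

(* (i, j) \<in> r means that i precedes j. Antisymmetry is not required. *)
definition directed_set :: "'i set \<Rightarrow> ('i \<times> 'i) set \<Rightarrow> bool" where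
  "directed_set J r \<longleftrightarrow>
     J \<noteq> {} \<and> preorder_on J r \<and> (\<forall>i\<in>J. \<forall>j\<in>J. \<exists>k\<in>J. (i, k) \<in> r \<and> (j, k) \<in> r)"

(* Filter generated by the tails of a directed set, as at_top is for a linear order. *)
definition tails :: "'i set \<Rightarrow> ('i \<times> 'i) set \<Rightarrow> 'i filter" where
  "tails J r = (INF j\<in>J. principal {k \<in> J. (j, k) \<in> r})"

definition increasing_net :: "'i set \<Rightarrow> ('i \<times> 'i) set \<Rightarrow> ('i \<Rightarrow> 'a::order) \<Rightarrow> bool" where
  "increasing_net J r x \<longleftrightarrow>
     directed_set J r \<and> monotone_on J (\<lambda>i j. (i, j) \<in> r) (\<le>) x"

definition net_convergent ::
    "'i set \<Rightarrow> ('i \<times> 'i) set \<Rightarrow> ('i \<Rightarrow> 'a::topological_space) \<Rightarrow> bool" where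
  "net_convergent J r x \<longleftrightarrow> (\<exists>l. (x \<longlongrightarrow> l) (tails J r))"

definition levi_property :: "'a::ordered_banach itself \<Rightarrow> bool" where
  "levi_property _ \<longleftrightarrow>
     (\<forall>x :: nat \<Rightarrow> 'a. incseq x \<longrightarrow> (\<exists>z. upper_bound (range x) z) \<longrightarrow> convergent x)"

(* A formula cannot quantify over types, so the type 'i from which the index sets are drawn is a
   parameter of the following two properties. A statement about all nets is one for all 'i. *)
definition bounded_increasing_nets_converge ::
    "'i itself \<Rightarrow> 'a::ordered_banach itself \<Rightarrow> bool" where
  "bounded_increasing_nets_converge _ _ \<longleftrightarrow>
     (\<forall>(J :: 'i set) r (x :: 'i \<Rightarrow> 'a).
        increasing_net J r x \<longrightarrow> (\<exists>z. upper_bound (x ` J) z) \<longrightarrow> net_convergent J r x)"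

definition minimally_bounded_increasing_nets_converge ::
    "'i itself \<Rightarrow> 'a::ordered_banach itself \<Rightarrow> bool" where
  "minimally_bounded_increasing_nets_converge _ _ \<longleftrightarrow>
     (\<forall>(J :: 'i set) r (x :: 'i \<Rightarrow> 'a).
        increasing_net J r x \<longrightarrow> (\<exists>z. minimal_upper_bound (x ` J) z) \<longrightarrow> net_convergent J r x)"

definition normal_cone :: "'a::ordered_banach itself \<Rightarrow> bool" where
  "normal_cone _ \<longleftrightarrow>
     (\<exists>C\<ge>0. \<forall>x y :: 'a. 0 \<le> x \<longrightarrow> x \<le> y \<longrightarrow> norm x \<le> C * norm y)"

end

theory Submission
  imports Defs
begin

text \<open>
  A bounded increasing net whose tails are not small in norm contains a bounded increasing
  sequence with steps of norm at least \<open>e > 0\<close>, which contradicts the Levi property. Hence some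
  increasing sequence picked from the net has tails of the net within \<open>1 / (n + 1)\<close> of its
  \<open>n\<close>-th term, and its limit is the limit of the net.

  Conversely, let \<open>x\<close> be an increasing sequence with an upper bound \<open>z\<close>, which need not dominate
  any minimal upper bound of \<open>x\<close>. Let \<open>U\<close> be the set of all \<open>v\<close> with \<open>x n + v \<le> z\<close> for
  every \<open>n\<close>, and let \<open>D\<close> be a maximal upward directed subset of \<open>U\<close> that contains \<open>0\<close>. Then \<open>z\<close> is a
  minimal upper bound of the directed set of all \<open>x n + v\<close> with \<open>v \<in> D\<close>. Indeed, if
  \<open>z - w\<close> with \<open>0 \<le> w\<close> is an upper bound too, then \<open>D + w\<close> lies in \<open>U\<close>, and since
  \<open>D \<union> (D + w)\<close> is directed, maximality gives \<open>D + w \<subseteq> D\<close>. So \<open>D\<close> contains all multiples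
  \<open>k w\<close>, which are therefore bounded by \<open>z - x 0\<close>, and \<open>w = 0\<close> because a closed cone is
  Archimedean. Convergence of the net \<open>x n + v\<close> forces the sequence \<open>x\<close> to be Cauchy: fix
  \<open>v\<close> and let \<open>n\<close> grow.

  If the cone is not normal, there are \<open>0 \<le> x n \<le> y n\<close> with \<open>norm (x n) = 1\<close> and
  \<open>norm (y n) \<le> 2\<^sup>-\<^sup>n\<close>. The partial sums of \<open>x\<close> increase and are bounded by the sum of \<open>y\<close>, so
  under the Levi property they converge, whence \<open>x n\<close> tends to \<open>0\<close>, a contradiction.
\<close>

section \<open>Closed cones and limits\<close>

lemma tendsto_ge_const:
  fixes x :: "nat \<Rightarrow> 'a::ordered_banach"
  assumes "x \<longlonglongrightarrow> l" and "\<And>n. n \<ge> N \<Longrightarrow> a \<le> x n"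
  shows "a \<le> l"
proof -
  have "(\<lambda>n. x n - a) \<longlonglongrightarrow> l - a"
    using assms(1) by (intro tendsto_intros)
  moreover have "\<forall>\<^sub>F n in sequentially. x n - a \<in> {0..}"
    using assms(2) by (auto simp: eventually_sequentially)
  ultimately have "l - a \<in> {0..}"
    by (intro Lim_in_closed_set[OF closed_cone _ trivial_limit_sequentially])
  then show ?thesis by simp
qed

lemma archimedean_cone:
  fixes w b :: "'a::ordered_banach"
  assumes "\<And>k::nat. of_nat k *\<^sub>R w \<le> b"
  shows "w \<le> 0"
proof -
  have "0 \<le> inverse (real (Suc k)) *\<^sub>R b - w" for k
  proof -
    have "inverse (real (Suc k)) *\<^sub>R (real (Suc k) *\<^sub>R w) \<le> inverse (real (Suc k)) *\<^sub>R b"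
      by (intro scaleR_left_mono assms) auto
    then show ?thesis by (simp del: of_nat_Suc)
  qed
  moreover have "(\<lambda>k. inverse (real (Suc k)) *\<^sub>R b - w) \<longlonglongrightarrow> 0 *\<^sub>R b - w"
    by (intro tendsto_intros LIMSEQ_inverse_real_of_nat)
  ultimately have "0 \<le> 0 *\<^sub>R b - w"
    by (rule tendsto_ge_const[rotated])
  then show ?thesis by simp
qed

section \<open>From sequences to nets\<close>

lemma eventually_tails:
  assumes "directed_set J r"
  shows "eventually P (tails J r) \<longleftrightarrow> (\<exists>j\<in>J. \<forall>k\<in>J. (j, k) \<in> r \<longrightarrow> P k)"
proof -
  have tr: "trans r"
    using assms by (auto simp: directed_set_def preorder_on_def)
  have "eventually P (tails J r) \<longleftrightarrow> (\<exists>j\<in>J. eventually P (principal {k \<in> J. (j, k) \<in> r}))"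
    unfolding tails_def
  proof (rule eventually_INF_base)
    show "J \<noteq> {}" using assms by (auto simp: directed_set_def)
  next
    fix a b assume "a \<in> J" "b \<in> J"
    then obtain k where "k \<in> J" "(a, k) \<in> r" "(b, k) \<in> r"
      using assms unfolding directed_set_def by blast
    then show "\<exists>x\<in>J. principal {k \<in> J. (x, k) \<in> r}
                 \<le> inf (principal {k \<in> J. (a, k) \<in> r}) (principal {k \<in> J. (b, k) \<in> r})"
      using tr by (auto intro!: bexI[of _ k] dest: transD)
  qed
  then show ?thesis by (auto simp: eventually_principal)
qed

text \<open>The Cauchy property of a bounded increasing net. The index \<open>j\<close> is found above any given
  \<open>j0\<close>, so that indices for ever smaller \<open>e\<close> can be chosen increasingly.\<close>

lemma levi_imp_small_tail:
  fixes x :: "'i \<Rightarrow> 'a::ordered_banach"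
  assumes levi: "levi_property TYPE('a)"
    and net: "increasing_net J r x" and ub: "upper_bound (x ` J) z"
    and e: "0 < e" and j0: "j0 \<in> J"
  shows "\<exists>j\<in>J. (j0, j) \<in> r \<and> (\<forall>k\<in>J. (j, k) \<in> r \<longrightarrow> norm (x k - x j) < e)"
proof (rule ccontr)
  assume "\<not> ?thesis"
  then have far: "\<exists>k\<in>J. (j, k) \<in> r \<and> e \<le> norm (x k - x j)" if "j \<in> J" "(j0, j) \<in> r" for j
    using that by (auto simp: not_less)
  have r: "refl_on J r" "trans r"
    and mono: "\<And>i j. i \<in> J \<Longrightarrow> j \<in> J \<Longrightarrow> (i, j) \<in> r \<Longrightarrow> x i \<le> x j"
    using net by (auto simp: increasing_net_def directed_set_def preorder_on_def monotone_on_def)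
  have "\<exists>f. \<forall>n::nat. (f n \<in> J \<and> (j0, f n) \<in> r) \<and>
              ((f n, f (Suc n)) \<in> r \<and> e \<le> norm (x (f (Suc n)) - x (f n)))"
  proof (rule dependent_nat_choice)
    show "\<exists>j. j \<in> J \<and> (j0, j) \<in> r"
      using j0 r by (auto dest: refl_onD)
  next
    fix j assume "j \<in> J \<and> (j0, j) \<in> r"
    then show "\<exists>k. (k \<in> J \<and> (j0, k) \<in> r) \<and> ((j, k) \<in> r \<and> e \<le> norm (x k - x j))"
      using far[of j] r(2) by (meson transD)
  qed
  then obtain f where f: "\<And>n. f n \<in> J" "\<And>n. (f n, f (Suc n)) \<in> r"
      and step: "\<And>n. e \<le> norm (x (f (Suc n)) - x (f n))"
    by blast
  have "incseq (x \<circ> f)"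
    by (rule incseq_SucI) (simp add: mono f)
  moreover have "upper_bound (range (x \<circ> f)) z"
    using ub f by (auto simp: upper_bound_def)
  ultimately have "convergent (x \<circ> f)"
    using levi unfolding levi_property_def by blast
  then have "Cauchy (x \<circ> f)"
    by (simp add: convergent_Cauchy)
  then obtain N where "norm ((x \<circ> f) (Suc N) - (x \<circ> f) N) < e"
    using e by (meson CauchyD le_SucI order_refl)
  with step[of N] show False by simp
qed

lemma levi_imp_bounded_increasing_nets_converge:
  assumes levi: "levi_property TYPE('a::ordered_banach)"
  shows "bounded_increasing_nets_converge TYPE('i) TYPE('a)"
  unfolding bounded_increasing_nets_converge_def
proof (intro allI impI)
  fix J :: "'i set" and r and x :: "'i \<Rightarrow> 'a"
  assume net: "increasing_net J r x" and "\<exists>z. upper_bound (x ` J) z"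
  then obtain z where ub: "upper_bound (x ` J) z" by blast
  have dir: "directed_set J r"
    and mono: "\<And>i j. i \<in> J \<Longrightarrow> j \<in> J \<Longrightarrow> (i, j) \<in> r \<Longrightarrow> x i \<le> x j"
    using net by (auto simp: increasing_net_def monotone_on_def)
  define near where "near n j \<longleftrightarrow>
      (\<forall>k\<in>J. (j, k) \<in> r \<longrightarrow> norm (x k - x j) < inverse (real (Suc n)))" for n j
  have ex: "\<exists>j\<in>J. (j0, j) \<in> r \<and> near n j" if "j0 \<in> J" for j0 n
    unfolding near_def by (rule levi_imp_small_tail[OF levi net ub _ that]) simp
  have "\<exists>f. \<forall>n::nat. (f n \<in> J \<and> near n (f n)) \<and> (f n, f (Suc n)) \<in> r"
  proof (rule dependent_nat_choice)
    show "\<exists>j. j \<in> J \<and> near 0 j"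
      using ex dir unfolding directed_set_def by blast
  next
    fix j n assume "j \<in> J \<and> near n j"
    then show "\<exists>k. (k \<in> J \<and> near (Suc n) k) \<and> (j, k) \<in> r"
      using ex[of j "Suc n"] by blast
  qed
  then obtain f where f: "\<And>n. f n \<in> J" "\<And>n. (f n, f (Suc n)) \<in> r"
      and near: "\<And>n. near n (f n)"
    by blast
  have "incseq (x \<circ> f)"
    by (rule incseq_SucI) (simp add: mono f)
  moreover have "upper_bound (range (x \<circ> f)) z"
    using ub f by (auto simp: upper_bound_def)
  ultimately have "convergent (x \<circ> f)"
    using levi unfolding levi_property_def by blast
  then obtain l where l: "(x \<circ> f) \<longlonglongrightarrow> l"
    by (auto simp: convergent_def)
  have "(x \<longlongrightarrow> l) (tails J r)"
  proof (rule tendstoI)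
    fix e :: real assume "0 < e"
    then have "\<forall>\<^sub>F n in sequentially. dist ((x \<circ> f) n) l < e / 2"
      and "\<forall>\<^sub>F n in sequentially. inverse (real (Suc n)) < e / 2"
      using tendstoD[OF l, of "e / 2"] order_tendstoD(2)[OF LIMSEQ_inverse_real_of_nat, of "e / 2"]
      by auto
    then have "\<forall>\<^sub>F n in sequentially. dist (x (f n)) l < e / 2 \<and> inverse (real (Suc n)) < e / 2"
      by eventually_elim simp
    then obtain n where n: "dist (x (f n)) l < e / 2" "inverse (real (Suc n)) < e / 2"
      by (auto simp: eventually_sequentially)
    have "dist (x k) l < e" if "k \<in> J" "(f n, k) \<in> r" for k
    proof -
      have "dist (x k) (x (f n)) < e / 2"
        using near[of n] n(2) that unfolding near_def dist_norm by fastforce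
      then show ?thesis
        using n(1) dist_triangle_half_l[of "x k" "x (f n)" e l] by (simp add: dist_commute)
    qed
    then show "\<forall>\<^sub>F k in tails J r. dist (x k) l < e"
      unfolding eventually_tails[OF dir] using f(1) by blast
  qed
  then show "net_convergent J r x"
    by (auto simp: net_convergent_def)
qed

lemma bounded_imp_minimally_bounded_increasing_nets_converge:
  assumes "bounded_increasing_nets_converge TYPE('i) TYPE('a::ordered_banach)"
  shows "minimally_bounded_increasing_nets_converge TYPE('i) TYPE('a)"
  unfolding minimally_bounded_increasing_nets_converge_def
proof (intro allI impI)
  fix J :: "'i set" and r and x :: "'i \<Rightarrow> 'a"
  assume net: "increasing_net J r x" and "\<exists>z. minimal_upper_bound (x ` J) z"
  then have "\<exists>z. upper_bound (x ` J) z"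
    by (auto simp: minimal_upper_bound_def)
  with net show "net_convergent J r x"
    using assms by (simp add: bounded_increasing_nets_converge_def)
qed

section \<open>From minimally bounded nets to sequences\<close>

text \<open>Every two elements of \<open>D\<close> have a common upper bound within \<open>D\<close>. The empty set is
  admitted.\<close>

definition up_directed :: "'a::order set \<Rightarrow> bool" where
  "up_directed D \<longleftrightarrow> (\<forall>a\<in>D. \<forall>b\<in>D. \<exists>c\<in>D. a \<le> c \<and> b \<le> c)"

lemma up_directed_Union_chain:
  assumes "subset.chain \<A> \<C>" and "\<And>D. D \<in> \<C> \<Longrightarrow> up_directed D"
  shows "up_directed (\<Union>\<C>)"
  unfolding up_directed_def
proof (intro ballI)
  fix a b assume "a \<in> \<Union>\<C>" "b \<in> \<Union>\<C>"
  then obtain A B where AB: "A \<in> \<C>" "B \<in> \<C>" "a \<in> A" "b \<in> B" by blast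
  with assms(1) have "A \<subseteq> B \<or> B \<subseteq> A"
    by (auto simp: subset_chain_def)
  then obtain D where "D \<in> \<C>" "a \<in> D" "b \<in> D"
    using AB by blast
  with assms(2) show "\<exists>c\<in>\<Union>\<C>. a \<le> c \<and> b \<le> c"
    unfolding up_directed_def by blast
qed

lemma exists_maximal_up_directed:
  assumes "u \<in> U"
  shows "\<exists>D. u \<in> D \<and> D \<subseteq> U \<and> up_directed D \<and>
    (\<forall>E. D \<subseteq> E \<and> E \<subseteq> U \<and> up_directed E \<longrightarrow> E = D)"
proof -
  define \<A> where "\<A> = {D. u \<in> D \<and> D \<subseteq> U \<and> up_directed D}"
  have "\<exists>M\<in>\<A>. \<forall>X\<in>\<A>. M \<subseteq> X \<longrightarrow> X = M"
  proof (rule subset_Zorn_nonempty)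
    have "{u} \<in> \<A>" using assms by (auto simp: \<A>_def up_directed_def)
    then show "\<A> \<noteq> {}" by blast
  next
    fix \<C> assume "\<C> \<noteq> {}" and chain: "subset.chain \<A> \<C>"
    then have "\<C> \<subseteq> \<A>" by (auto simp: subset_chain_def)
    moreover from this have "up_directed (\<Union>\<C>)"
      by (intro up_directed_Union_chain[OF chain]) (auto simp: \<A>_def)
    ultimately show "\<Union>\<C> \<in> \<A>"
      using \<open>\<C> \<noteq> {}\<close> by (auto simp: \<A>_def)
  qed
  then obtain M where M: "M \<in> \<A>" and max: "\<forall>X\<in>\<A>. M \<subseteq> X \<longrightarrow> X = M" by blast
  from M have M': "u \<in> M" "M \<subseteq> U" "up_directed M" by (auto simp: \<A>_def)
  moreover have "E = M" if "M \<subseteq> E" "E \<subseteq> U" "up_directed E" for E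
    using that M'(1) by (intro max[rule_format]) (auto simp: \<A>_def)
  ultimately show ?thesis by (intro exI[of _ M]) simp
qed

text \<open>Directed sets are used here instead of chains because \<open>D \<union> (D + w)\<close> is directed whenever
  \<open>D\<close> is, whereas it need not be a chain if \<open>D\<close> is one.\<close>

lemma maximal_up_directed_translate_eq_zero:
  fixes w :: "'a::ordered_banach"
  assumes u: "u \<in> D" and dir: "up_directed D"
    and max: "\<And>E. D \<subseteq> E \<Longrightarrow> E \<subseteq> U \<Longrightarrow> up_directed E \<Longrightarrow> E = D"
    and sub: "D \<subseteq> U" and bd: "upper_bound U b"
    and w: "0 \<le> w" and translate: "\<And>v. v \<in> D \<Longrightarrow> v + w \<in> U"
  shows "w = 0"
proof -
  define E where "E = D \<union> (\<lambda>v. v + w) ` D"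
  have "up_directed E"
    unfolding up_directed_def
  proof (intro ballI)
    \<comment> \<open>Every element of \<open>E\<close> lies below some translate \<open>v + w\<close> with \<open>v \<in> D\<close>.\<close>
    have dom: "\<exists>v\<in>D. a \<le> v + w" if "a \<in> E" for a
      using that w by (auto simp: E_def intro: bexI[of _ a])
    fix a b assume "a \<in> E" "b \<in> E"
    then obtain v v' where v: "v \<in> D" "v' \<in> D" "a \<le> v + w" "b \<le> v' + w"
      using dom by blast
    then obtain c where "c \<in> D" "v \<le> c" "v' \<le> c"
      using dir unfolding up_directed_def by blast
    with v show "\<exists>c\<in>E. a \<le> c \<and> b \<le> c"
      by (intro bexI[of _ "c + w"]) (auto simp: E_def intro: order_trans add_right_mono)
  qed
  moreover have "D \<subseteq> E" "E \<subseteq> U"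
    using sub translate by (auto simp: E_def)
  ultimately have "E = D" using max by blast
  then have shift: "v + w \<in> D" if "v \<in> D" for v
    using that by (auto simp: E_def)
  have "u + of_nat k *\<^sub>R w \<in> D" for k
  proof (induction k)
    case 0
    show ?case using u by simp
  next
    case (Suc k)
    from shift[OF this] show ?case by (simp add: algebra_simps)
  qed
  then have "of_nat k *\<^sub>R w \<le> b - u" for k
    using bd sub by (auto simp: upper_bound_def le_diff_eq add.commute)
  then have "w \<le> 0" by (rule archimedean_cone)
  with w show ?thesis by simp
qed

text \<open>The bound \<open>z\<close> becomes minimal once the sequence is enlarged by all translates along a
  suitable directed set.\<close>

lemma exists_up_directed_translates_minimal_upper_bound:
  fixes x :: "nat \<Rightarrow> 'a::ordered_banach"
  assumes ub: "upper_bound (range x) z"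
  obtains D where "0 \<in> D" "up_directed D"
    "minimal_upper_bound {x n + v | n v. v \<in> D} z"
proof -
  define U where "U = {v. \<forall>n. x n + v \<le> z}"
  have "0 \<in> U" using ub by (auto simp: U_def upper_bound_def)
  from exists_maximal_up_directed[OF this]
  obtain D where D: "0 \<in> D" "D \<subseteq> U" "up_directed D"
    and "\<forall>E. D \<subseteq> E \<and> E \<subseteq> U \<and> up_directed E \<longrightarrow> E = D"
    by (elim exE conjE)
  then have max: "E = D" if "D \<subseteq> E" "E \<subseteq> U" "up_directed E" for E
    using that by simp
  have "minimal_upper_bound {x n + v | n v. v \<in> D} z"
    unfolding minimal_upper_bound_def
  proof (intro conjI allI impI)
    show "upper_bound {x n + v | n v. v \<in> D} z"
      using D(2) by (auto simp: upper_bound_def U_def)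
  next
    fix z' assume z': "upper_bound {x n + v | n v. v \<in> D} z'" and "z' \<le> z"
    have "z - z' = 0"
    proof (rule maximal_up_directed_translate_eq_zero[OF D(1) D(3) max D(2)])
      show "upper_bound U (z - x 0)"
        by (auto simp: upper_bound_def U_def le_diff_eq add.commute)
      show "0 \<le> z - z'" using \<open>z' \<le> z\<close> by simp
      show "v + (z - z') \<in> U" if "v \<in> D" for v
      proof -
        have "x n + v \<le> z'" for n
          using z' that by (auto simp: upper_bound_def)
        then have "x n + (v + (z - z')) \<le> z" for n
          using add_right_mono[of "x n + v" z' "z - z'"] by (simp add: add.assoc)
        then show ?thesis by (simp add: U_def)
      qed
    qed
    then show "z' = z" by simp
  qed
  with D show thesis by (intro that)
qed

text \<open>The net is the identity on the directed set of all \<open>x n + v\<close>, so it is indexed by a subset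
  of the space itself.\<close>

lemma minimally_bounded_increasing_nets_converge_imp_levi:
  assumes nets: "minimally_bounded_increasing_nets_converge TYPE('a) TYPE('a::ordered_banach)"
  shows "levi_property TYPE('a)"
  unfolding levi_property_def
proof (intro allI impI)
  fix x :: "nat \<Rightarrow> 'a"
  assume inc: "incseq x" and "\<exists>z. upper_bound (range x) z"
  then obtain z where "upper_bound (range x) z" by blast
  then obtain D where D: "0 \<in> D" "up_directed D"
    and mub: "minimal_upper_bound {x n + v | n v. v \<in> D} z"
    by (rule exists_up_directed_translates_minimal_upper_bound)
  define S where "S = {x n + v | n v. v \<in> D}"
  define r where "r = {(a, b). a \<in> S \<and> b \<in> S \<and> a \<le> b}"
  have dir: "directed_set S r"
    unfolding directed_set_def
  proof (intro conjI ballI)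
    show "S \<noteq> {}" using D(1) by (auto simp: S_def)
    show "preorder_on S r"
      by (auto simp: preorder_on_def refl_on_def trans_def r_def)
  next
    fix a b assume ab: "a \<in> S" "b \<in> S"
    then obtain m u n v where eq: "a = x m + u" "b = x n + v" "u \<in> D" "v \<in> D"
      by (auto simp: S_def)
    then obtain c where c: "c \<in> D" "u \<le> c" "v \<le> c"
      using D(2) unfolding up_directed_def by blast
    have "x m \<le> x (max m n)" "x n \<le> x (max m n)"
      using inc by (simp_all add: incseqD)
    with c eq have "a \<le> x (max m n) + c" "b \<le> x (max m n) + c"
      by (simp_all add: add_mono)
    moreover have "x (max m n) + c \<in> S"
      using c by (auto simp: S_def)
    ultimately show "\<exists>k\<in>S. (a, k) \<in> r \<and> (b, k) \<in> r"
      using ab unfolding r_def by blast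
  qed
  moreover have "monotone_on S (\<lambda>i j. (i, j) \<in> r) (\<le>) (\<lambda>s. s)"
    by (auto simp: monotone_on_def r_def)
  ultimately have "increasing_net S r (\<lambda>s. s)"
    by (simp add: increasing_net_def)
  moreover have "minimal_upper_bound ((\<lambda>s. s) ` S) z"
    using mub by (simp add: S_def)
  ultimately have "net_convergent S r (\<lambda>s. s)"
    using nets unfolding minimally_bounded_increasing_nets_converge_def by blast
  then obtain l where l: "((\<lambda>s. s) \<longlongrightarrow> l) (tails S r)"
    by (auto simp: net_convergent_def)
  have "Cauchy x"
  proof (rule metric_CauchyI)
    fix e :: real assume "0 < e"
    then have "\<forall>\<^sub>F s in tails S r. dist s l < e / 2"
      using tendstoD[OF l, of "e / 2"] by simp
    then obtain s where s: "s \<in> S" and near: "\<And>t. t \<in> S \<Longrightarrow> (s, t) \<in> r \<Longrightarrow> dist t l < e / 2"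
      unfolding eventually_tails[OF dir] by blast
    from s obtain N v where Nv: "s = x N + v" "v \<in> D" by (auto simp: S_def)
    have "dist (x n + v) l < e / 2" if "n \<ge> N" for n
    proof (rule near)
      show "x n + v \<in> S" using Nv by (auto simp: S_def)
      with s show "(s, x n + v) \<in> r"
        using Nv incseqD[OF inc that] by (simp add: r_def)
    qed
    then have "dist (x m + v) (x n + v) < e" if "m \<ge> N" "n \<ge> N" for m n
      using that dist_triangle_half_l by blast
    then show "\<exists>N. \<forall>m\<ge>N. \<forall>n\<ge>N. dist (x m) (x n) < e"
      by auto
  qed
  then show "convergent x" by (rule Cauchy_convergent)
qed

section \<open>Normality\<close>

lemma levi_imp_terms_tendsto_zero:
  fixes x y :: "nat \<Rightarrow> 'a::ordered_banach"
  assumes levi: "levi_property TYPE('a)"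
    and xy: "\<And>n. 0 \<le> x n" "\<And>n. x n \<le> y n" and "summable y"
  shows "x \<longlonglongrightarrow> 0"
proof -
  have pos: "0 \<le> y n" for n using xy order_trans by blast
  have "(\<Sum>k<n. x k) \<le> suminf y" for n
  proof (rule order_trans)
    show "(\<Sum>k<n. x k) \<le> (\<Sum>k<n. y k)" by (intro sum_mono xy)
    show "(\<Sum>k<n. y k) \<le> suminf y"
      by (rule tendsto_ge_const[OF summable_LIMSEQ[OF \<open>summable y\<close>]])
         (auto intro!: sum_mono2 pos)
  qed
  then have "upper_bound (range (\<lambda>n. \<Sum>k<n. x k)) (suminf y)"
    by (auto simp: upper_bound_def)
  moreover have "incseq (\<lambda>n. \<Sum>k<n. x k)"
    by (rule incseq_SucI) (simp add: xy)
  ultimately have "convergent (\<lambda>n. \<Sum>k<n. x k)"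
    using levi unfolding levi_property_def by blast
  then show ?thesis
    by (intro summable_LIMSEQ_zero) (simp add: summable_iff_convergent)
qed

lemma levi_imp_normal_cone:
  assumes levi: "levi_property TYPE('a::ordered_banach)"
  shows "normal_cone TYPE('a)"
proof (rule ccontr)
  assume nn: "\<not> normal_cone TYPE('a)"
  have "\<exists>x y :: 'a. 0 \<le> x \<and> x \<le> y \<and> 2 ^ n * norm y < norm x" for n
  proof -
    have "(0::real) \<le> 2 ^ n" by simp
    with nn show ?thesis
      unfolding normal_cone_def by (meson not_le)
  qed
  then obtain x y :: "nat \<Rightarrow> 'a" where xy: "\<And>n. 0 \<le> x n" "\<And>n. x n \<le> y n"
      and big: "\<And>n. 2 ^ n * norm (y n) < norm (x n)"
    by metis
  have pos: "0 < norm (x n)" for n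
    using le_less_trans[OF _ big[of n], of 0] by simp
  define c where "c n = inverse (norm (x n))" for n
  have c: "0 \<le> c n" for n by (simp add: c_def)
  have small: "norm (c n *\<^sub>R y n) \<le> (1 / 2) ^ n" for n
  proof -
    have "norm (c n *\<^sub>R y n) = norm (y n) / norm (x n)"
      by (simp add: c_def divide_inverse mult.commute)
    also have "\<dots> \<le> (1 / 2) ^ n"
      using big[of n] pos[of n] by (simp add: field_simps power_divide)
    finally show ?thesis .
  qed
  have "summable (\<lambda>n. (1 / 2 :: real) ^ n)"
    by (rule summable_geometric) simp
  then have summable: "summable (\<lambda>n. c n *\<^sub>R y n)"
    by (rule summable_comparison_test'[where N = 0]) (rule small)
  have "(\<lambda>n. c n *\<^sub>R x n) \<longlonglongrightarrow> 0"
    by (rule levi_imp_terms_tendsto_zero[OF levi _ _ summable])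
       (simp_all add: scaleR_left_mono scaleR_nonneg_nonneg xy c)
  then have "(\<lambda>n. norm (c n *\<^sub>R x n)) \<longlonglongrightarrow> 0"
    by (rule tendsto_norm_zero)
  moreover have "norm (c n *\<^sub>R x n) = 1" for n
    using pos[of n] by (simp add: c_def)
  ultimately show False by (simp add: LIMSEQ_const_iff)
qed

section \<open>The equivalence\<close>

(* For each implication the index type is chosen so that the implication is strongest:
   when net convergence is a conclusion, the index type 'i is arbitrary;
   when it is a premise, only nets indexed by subsets of the space 'a itself are needed. *)
theorem theorem2p1:
  shows
    "(levi_property TYPE('a::ordered_banach) \<longleftrightarrow>
        bounded_increasing_nets_converge TYPE('a) TYPE('a)) \<and>
     (levi_property TYPE('a) \<longleftrightarrow>
        minimally_bounded_increasing_nets_converge TYPE('a) TYPE('a)) \<and>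
     (levi_property TYPE('a) \<longrightarrow>
        bounded_increasing_nets_converge TYPE('i) TYPE('a) \<and>
        minimally_bounded_increasing_nets_converge TYPE('i) TYPE('a)) \<and>
     (levi_property TYPE('a) \<longrightarrow> normal_cone TYPE('a))"
proof -
  have "levi_property TYPE('a)"
    if "minimally_bounded_increasing_nets_converge TYPE('a) TYPE('a)"
    using that by (rule minimally_bounded_increasing_nets_converge_imp_levi)
  moreover have "minimally_bounded_increasing_nets_converge TYPE('a) TYPE('a)"
    if "bounded_increasing_nets_converge TYPE('a) TYPE('a)"
    using that by (rule bounded_imp_minimally_bounded_increasing_nets_converge)
  moreover have "bounded_increasing_nets_converge TYPE('a) TYPE('a)" if "levi_property TYPE('a)"
    using that by (rule levi_imp_bounded_increasing_nets_converge)
  moreover have "bounded_increasing_nets_converge TYPE('i) TYPE('a)" if "levi_property TYPE('a)"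
    using that by (rule levi_imp_bounded_increasing_nets_converge)
  moreover have "minimally_bounded_increasing_nets_converge TYPE('i) TYPE('a)"
    if "bounded_increasing_nets_converge TYPE('i) TYPE('a)"
    using that by (rule bounded_imp_minimally_bounded_increasing_nets_converge)
  moreover have "normal_cone TYPE('a)" if "levi_property TYPE('a)"
    using that by (rule levi_imp_normal_cone)
  ultimately show ?thesis by argo
qed

end
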